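(* Let $T$ be a tree with $n\geq 2$ vertices. For any vertex $v\in C(T)$, \[\frac{\operatorname{Ecc}(T)}{\operatorname{ecc}_T(v)} \leq 2n-1.\] For $n\geq 3$, equality holds if and only if $T$ is a star centered at $v$.
   Context: For a vertex $v$ of a tree $T$, $\operatorname{ecc}_T(v)=\max_{u\in V(T)} d_T(u,v)$, where $d_T$ is the distance in $T$. The total eccentricity is $\operatorname{Ecc}(T)=\sum_{z\in V(T)}\operatorname{ecc}_T(z)$. The center $C(T)$ is the set of vertices of minimum eccentricity (the radius). *)

theory Defs
  imports "Graph_Theory.Graph_Theory"
begin

text \<open>
  Finite simple undirected graphs are modelled by the locale \<^locale>\<open>graph\<close>: finite loop-free
  digraphs without parallel arcs whose arc relation is symmetric.
\<close>

text \<open>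
  The predicate \<open>Digraph_Component.tree\<close> does not fit this model: for a symmetric arc
  relation it forbids edges altogether, since traversing an edge back and forth is a
  \<open>cycle\<close> of length 2. The cycles of an undirected graph are the ones of length at least 3.
\<close>

definition undirected_tree :: "('a, 'b) pre_digraph \<Rightarrow> bool" where
  "undirected_tree T \<longleftrightarrow>
     graph T \<and> Digraph_Component.connected T \<and> \<not> (\<exists>c. pre_digraph.cycle T c \<and> 3 \<le> length c)"

text \<open>
  The library distance takes values in \<^typ>\<open>ereal\<close>. Between vertices of a connected graph it
  is finite, so the conversion to \<^typ>\<open>real\<close> loses nothing.
\<close>

definition graph_dist :: "('a, 'b) pre_digraph \<Rightarrow> 'a \<Rightarrow> 'a \<Rightarrow> real" where
  "graph_dist T u v = real_of_ereal (wf_digraph.\<mu> T (\<lambda>_. 1) u v)"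

definition ecc :: "('a, 'b) pre_digraph \<Rightarrow> 'a \<Rightarrow> real" where
  "ecc T v = Max ((\<lambda>u. graph_dist T u v) ` verts T)"

definition total_ecc :: "('a, 'b) pre_digraph \<Rightarrow> real" where
  "total_ecc T = (\<Sum>z\<in>verts T. ecc T z)"

definition radius :: "('a, 'b) pre_digraph \<Rightarrow> real" where
  "radius T = Min (ecc T ` verts T)"

definition center :: "('a, 'b) pre_digraph \<Rightarrow> 'a set" where
  "center T = {v \<in> verts T. ecc T v = radius T}"

definition star_centered_at :: "('a, 'b) pre_digraph \<Rightarrow> 'a \<Rightarrow> bool" where
  "star_centered_at T v \<longleftrightarrow> v \<in> verts T \<and>
     arcs_ends T = {v} \<times> (verts T - {v}) \<union> (verts T - {v}) \<times> {v}"

end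

(*
  Going through v gives ecc z \<le> ecc v + d(v,z) \<le> 2 ecc v for every z, and summing over
  z \<noteq> v gives the bound. Equality forces d(v,z) = ecc v for all z \<noteq> v; a neighbour of v
  exists, so ecc v = 1 and every other vertex is adjacent to v. An edge avoiding v would
  then close a triangle.
*)
theory Submission
  imports Defs
begin

context wf_digraph
begin

lemma awalk_cost_unit: "awalk_cost (\<lambda>_. 1) p = real (length p)"
  by (induction p) auto

text \<open>Walk lengths are natural numbers, so the infimum defining \<open>\<mu>\<close> is
  attained by a shortest walk. This replaces the extended real distance by the length of a concrete
  walk, on which the distance estimates below rest.\<close>

lemma exists_shortest_awalk:
  assumes "u \<rightarrow>\<^sup>* v"
  obtains p where "awalk u p v" "\<And>q. awalk u q v \<Longrightarrow> length p \<le> length q"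
    "graph_dist G u v = real (length p)"
proof -
  obtain p0 where "awalk u p0 v"
    using assms by (auto simp: reachable_awalk)
  then obtain p where p: "awalk u p v" and least: "\<And>q. awalk u q v \<Longrightarrow> length p \<le> length q"
    using arg_min_natI[of "\<lambda>p. awalk u p v" p0 length]
      arg_min_nat_le[of "\<lambda>p. awalk u p v" _ length] by metis
  have "\<mu> (\<lambda>_. 1) u v = ereal (real (length p))"
    unfolding \<mu>_def
    by (rule INF_eqI) (use p least in \<open>auto simp: awalk_cost_unit\<close>)
  then have "graph_dist G u v = real (length p)"
    by (simp add: graph_dist_def)
  with p least that show thesis by blast
qed

lemma graph_dist_le_length:
  assumes "awalk u p v"
  shows "graph_dist G u v \<le> real (length p)"
proof -
  have "u \<rightarrow>\<^sup>* v" using assms by (auto simp: reachable_awalk)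
  then show ?thesis using assms by (metis exists_shortest_awalk of_nat_le_iff)
qed

lemma graph_dist_triangle:
  assumes "u \<rightarrow>\<^sup>* v" "v \<rightarrow>\<^sup>* w"
  shows "graph_dist G u w \<le> graph_dist G u v + graph_dist G v w"
proof -
  obtain p q where "awalk u p v" "graph_dist G u v = length p"
    "awalk v q w" "graph_dist G v w = length q"
    using assms exists_shortest_awalk by metis
  then show ?thesis
    using graph_dist_le_length[OF awalk_appendI[of u p v q w]] by simp
qed

lemma graph_dist_self_le: "v \<in> verts G \<Longrightarrow> graph_dist G v v \<le> 0"
  using graph_dist_le_length[of v "[]" v] by (simp add: awalk_Nil_iff)

lemma graph_dist_adj:
  assumes "u \<rightarrow> v"
  shows "graph_dist G u v \<le> 1"
proof -
  obtain e where "e \<in> arcs G" "tail G e = u" "head G e = v" using assms by blast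
  then have "awalk u [e] v" using arc_implies_awalk by blast
  then show ?thesis using graph_dist_le_length[of u "[e]" v] by simp
qed

lemma graph_dist_ge_1:
  assumes "u \<rightarrow>\<^sup>* v" "u \<noteq> v"
  shows "1 \<le> graph_dist G u v"
proof -
  obtain p where p: "awalk u p v" "graph_dist G u v = length p"
    using assms(1) exists_shortest_awalk by metis
  then have "p \<noteq> []" using assms(2) by (auto simp: awalk_Nil_iff)
  then show ?thesis using p by (cases p) auto
qed

text \<open>A walk of length 0 has equal ends and one of length 1 is an arc. Used in both directions
  of the equality case: to obtain adjacency from a distance at most 1, and to keep two leaves of a
  star at distance at least 2.\<close>

lemma graph_dist_ge_2:
  assumes "u \<rightarrow>\<^sup>* v" "u \<noteq> v" "\<not> u \<rightarrow> v"
  shows "2 \<le> graph_dist G u v"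
proof -
  obtain p where p: "awalk u p v" "graph_dist G u v = length p"
    using assms(1) exists_shortest_awalk by metis
  have "2 \<le> length p"
  proof (rule ccontr)
    assume "\<not> 2 \<le> length p"
    then consider "p = []" | e where "p = [e]"
      by (cases p; cases "tl p") auto
    then show False
      using p assms(2,3) by cases (auto simp: awalk_simps dest: in_arcs_imp_in_arcs_ends)
  qed
  then show ?thesis using p by simp
qed

lemma triangle_cycle:
  assumes "u \<rightarrow> v" "v \<rightarrow> w" "w \<rightarrow> u" "u \<noteq> v" "v \<noteq> w" "w \<noteq> u"
  shows "\<exists>c. cycle c \<and> length c = 3"
proof -
  obtain a b c where "a \<in> arcs G" "tail G a = u" "head G a = v"
    "b \<in> arcs G" "tail G b = v" "head G b = w"
    "c \<in> arcs G" "tail G c = w" "head G c = u"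
    using assms(1-3) by (meson reachableE)
  then have "cycle [a, b, c]"
    using assms(4-6) unfolding cycle_def
    by (intro exI[of _ u]) (auto simp: awalk_simps)
  then show ?thesis by force
qed

end

context sym_digraph
begin

text \<open>Symmetry relates only the ends of arcs, so an opposite arc \<open>e'\<close> is chosen
  for each arc of the walk and appended behind the reversed tail.\<close>

lemma exists_reverse_awalk:
  assumes "awalk u p v"
  shows "\<exists>q. awalk v q u \<and> length q = length p"
  using assms
proof (induction p arbitrary: u)
  case Nil
  then show ?case by (auto simp: awalk_Nil_iff)
next
  case (Cons e p)
  then obtain q where q: "awalk v q (head G e)" "length q = length p"
    by (auto simp: awalk_Cons_iff)
  obtain e' where "e' \<in> arcs G" "tail G e' = head G e" "head G e' = u"
    using Cons.prems sym_arcs unfolding symmetric_conv awalk_Cons_iff by metis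
  then have "awalk (head G e) [e'] u"
    using arc_implies_awalk by metis
  with q have "awalk v (q @ [e']) u" "length (q @ [e']) = length (e # p)"
    using awalk_appendI by auto
  then show ?case by blast
qed

lemma graph_dist_commute:
  assumes "u \<rightarrow>\<^sup>* v"
  shows "graph_dist G u v = graph_dist G v u"
proof -
  \<comment> \<open>Reversing a shortest walk gives one inequality; stated for all pairs, it yields
    the other by swapping the ends.\<close>
  have "graph_dist G y x \<le> graph_dist G x y" if "x \<rightarrow>\<^sup>* y" for x y
    using exists_shortest_awalk[OF that] exists_reverse_awalk graph_dist_le_length by metis
  then show ?thesis
    using assms symmetric_reachable' by (meson order_antisym)
qed

end

context fin_digraph
begin

lemma graph_dist_le_ecc: "u \<in> verts G \<Longrightarrow> graph_dist G u v \<le> ecc G v"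
  unfolding ecc_def by (rule Max_ge) auto

lemma ecc_attained:
  assumes "verts G \<noteq> {}"
  obtains u where "u \<in> verts G" "ecc G v = graph_dist G u v"
proof -
  have "ecc G v \<in> (\<lambda>u. graph_dist G u v) ` verts G"
    unfolding ecc_def using assms by (intro Max_in) auto
  then show thesis using that by blast
qed

end

theorem theorem2p1:
  fixes T :: "('a, 'b) pre_digraph" and n :: nat and v :: 'a
  assumes "undirected_tree T"
    and "card (verts T) = n"
    and "n \<ge> 2"
    and "v \<in> center T"
  shows "total_ecc T / ecc T v \<le> 2 * real n - 1 \<and>
    (n \<ge> 3 \<longrightarrow> (total_ecc T / ecc T v = 2 * real n - 1 \<longleftrightarrow> star_centered_at T v))"
proof -
  interpret graph T using assms(1) by (simp add: undirected_tree_def)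
  have "strongly_connected T"
    using assms(1) unfolding undirected_tree_def
    by (simp add: symmetric_connected_imp_strongly_connected sym_arcs)
  then have reach: "x \<rightarrow>\<^sup>*\<^bsub>T\<^esub> y" if "x \<in> verts T" "y \<in> verts T" for x y
    using that by blast
  have v: "v \<in> verts T" using assms(4) by (simp add: center_def)
  let ?r = "ecc T v" and ?W = "verts T - {v}"
  \<comment> \<open>\<open>ecc T v\<close> maximises distances towards \<open>v\<close>, so the
    direction has to be swapped.\<close>
  have dist_le: "graph_dist T v z \<le> ?r" if "z \<in> verts T" for z
    using graph_dist_le_ecc[OF that] graph_dist_commute[OF reach[OF v that]] by simp
  have ecc_le: "ecc T z \<le> ?r + graph_dist T v z" if z: "z \<in> verts T" for z
  proof -
    obtain u where u: "u \<in> verts T" "ecc T z = graph_dist T u z"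
      using z ecc_attained by blast
    then show ?thesis
      using graph_dist_triangle[OF reach reach, of u v z] graph_dist_le_ecc[of u v] v z
      by force
  qed
  have card_W: "card ?W = n - 1" using assms(2) v by simp
  \<comment> \<open>A second vertex makes the eccentricity of \<open>v\<close> positive, so the
    quotient is a genuine one; it also provides a target for a walk leaving
    \<open>v\<close>.\<close>
  then have "card ?W > 0" using assms(3) by simp
  then obtain z0 where z0: "z0 \<in> verts T" "z0 \<noteq> v" by (auto simp: card_gt_0_iff)
  have "1 \<le> ?r"
    using graph_dist_ge_1[of z0 v] graph_dist_le_ecc[of z0 v] reach z0 v by force
  then have r_pos: "0 < ?r" by simp
  \<comment> \<open>The term of \<open>v\<close> is exactly \<open>?r\<close>, while the other
    \<open>n - 1\<close> terms are bounded by \<open>2 * ?r\<close>: this is where the -1 in the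
    bound comes from.\<close>
  have total: "total_ecc T = ?r + (\<Sum>z\<in>?W. ecc T z)"
    unfolding total_ecc_def using v by (simp add: sum.remove)
  have const: "(\<Sum>z\<in>?W. 2 * ?r) = (2 * real n - 2) * ?r"
    using card_W assms(3) by (simp add: of_nat_diff algebra_simps)
  have ecc_le2: "ecc T z \<le> 2 * ?r" if "z \<in> ?W" for z
    using ecc_le[of z] dist_le[of z] that by simp
  have "(\<Sum>z\<in>?W. ecc T z) \<le> (2 * real n - 2) * ?r"
    unfolding const[symmetric] by (rule sum_mono) (rule ecc_le2)
  then have bound: "total_ecc T / ?r \<le> 2 * real n - 1"
    unfolding total pos_divide_le_eq[OF r_pos] by (simp add: algebra_simps)
  have eq_iff: "total_ecc T / ?r = 2 * real n - 1 \<longleftrightarrow> (\<forall>z\<in>?W. ecc T z = 2 * ?r)"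
  proof -
    have "total_ecc T / ?r = 2 * real n - 1 \<longleftrightarrow> total_ecc T = (2 * real n - 1) * ?r"
      using r_pos by (simp add: divide_eq_eq)
    \<comment> \<open>The deficits \<open>2 * ?r - ecc T z\<close> are nonnegative, so their sum
      vanishes only if each of them does.\<close>
    also have "\<dots> \<longleftrightarrow> (\<Sum>z\<in>?W. 2 * ?r - ecc T z) = 0"
      unfolding sum_subtractf const total by (auto simp: algebra_simps)
    also have "\<dots> \<longleftrightarrow> (\<forall>z\<in>?W. ecc T z = 2 * ?r)"
      by (subst sum_nonneg_eq_0_iff) (use ecc_le2 in \<open>force+\<close>)
    finally show ?thesis .
  qed
  have "star_centered_at T v" if eq: "\<forall>z\<in>?W. ecc T z = 2 * ?r"
  proof -
    \<comment> \<open>Both inequalities in \<open>ecc T z\<close> \<le>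
      \<open>?r + graph_dist T v z\<close> \<le> \<open>2 * ?r\<close> are now equalities.\<close>
    have dist_eq: "graph_dist T v z = ?r" if "z \<in> ?W" for z
      using that eq ecc_le[of z] dist_le[of z] by force
    \<comment> \<open>The first arc of a walk from \<open>v\<close> to \<open>z0\<close> provides
      the neighbour; its distance is at most 1 and equals \<open>?r\<close>.\<close>
    obtain w where w: "v \<rightarrow>\<^bsub>T\<^esub> w"
      using reach[OF v z0(1)] z0(2) by (metis converse_reachable_cases)
    then have "w \<in> ?W" using adj_in_verts adj_not_same by blast
    then have r1: "?r \<le> 1" using graph_dist_adj[OF w] dist_eq[of w] by simp
    have adj: "v \<rightarrow>\<^bsub>T\<^esub> z" if "z \<in> ?W" for z
      using graph_dist_ge_2[of v z] reach[of v z] that dist_eq[of z] r1 v by force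
    have adj': "z \<rightarrow>\<^bsub>T\<^esub> v" if "z \<in> ?W" for z
      by (rule graph_symmetric[OF adj[OF that]])
    \<comment> \<open>The only use of acyclicity: an arc avoiding \<open>v\<close> closes the
      triangle \<open>v\<close>, \<open>x\<close>, \<open>y\<close>, a cycle of length 3.\<close>
    have one_end: "x = v \<or> y = v" if xy: "x \<rightarrow>\<^bsub>T\<^esub> y" for x y
    proof (rule ccontr)
      assume "\<not> (x = v \<or> y = v)"
      moreover have "x \<in> verts T" "y \<in> verts T" "x \<noteq> y"
        using adj_in_verts[OF xy] xy adj_not_same by auto
      ultimately obtain c where "cycle c" "length c = 3"
        using triangle_cycle[of v x y] adj[of x] adj'[of y] xy by auto
      then show False using assms(1) unfolding undirected_tree_def by auto
    qed
    have "arcs_ends T = {v} \<times> ?W \<union> ?W \<times> {v}"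
    proof (rule set_eqI, clarify)
      fix x y
      show "x \<rightarrow>\<^bsub>T\<^esub> y \<longleftrightarrow> (x, y) \<in> {v} \<times> ?W \<union> ?W \<times> {v}"
        using adj[of y] adj'[of x] one_end[of x y] adj_in_verts[of x y] adj_not_same[of x] by auto
    qed
    then show ?thesis using v by (simp add: star_centered_at_def)
  qed
  moreover have "\<forall>z\<in>?W. ecc T z = 2 * ?r" if n: "n \<ge> 3" and star: "star_centered_at T v"
  proof
    fix z assume z: "z \<in> ?W"
    have ends: "arcs_ends T = {v} \<times> ?W \<union> ?W \<times> {v}"
      using star by (simp add: star_centered_at_def)
    obtain u where u: "u \<in> verts T" "?r = graph_dist T u v"
      using v ecc_attained by blast
    \<comment> \<open>A vertex \<open>u\<close> farthest from the centre of the star is either that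
      centre or adjacent to it.\<close>
    have r1: "?r \<le> 1"
    proof (cases "u = v")
      case True
      then show ?thesis using u graph_dist_self_le[of v] by simp
    next
      case False
      then have "u \<rightarrow>\<^bsub>T\<^esub> v" using u ends by blast
      then show ?thesis using u graph_dist_adj[of u v] by simp
    qed
    \<comment> \<open>Here \<open>n \<ge> 3\<close> enters: a second leaf \<open>y\<close> is at
      distance at least 2 from \<open>z\<close>. For \<open>n = 2\<close> both eccentricities are 1
      and the quotient is 2, not 3.\<close>
    have "card (?W - {z}) > 0" using n z card_W by simp
    then obtain y where y: "y \<in> verts T" "y \<noteq> v" "y \<noteq> z" by (auto simp: card_gt_0_iff)
    then have "\<not> y \<rightarrow>\<^bsub>T\<^esub> z" using ends z by blast
    then have "2 \<le> graph_dist T y z" using graph_dist_ge_2[of y z] reach y z by simp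
    then have "2 \<le> ecc T z" using graph_dist_le_ecc[OF y(1), of z] by simp
    then show "ecc T z = 2 * ?r" using r1 ecc_le2[OF z] by simp
  qed
  ultimately show ?thesis using bound unfolding eq_iff by blast
qed

end
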